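(* Let $\{S_n\}_{n\ge 0}$ be the one-dimensional elephant random walk with first-step parameter $q\in(0,1]$ and memory parameter $p\in(0,1)$, and let $\alpha:=2p-1$. (i) For $n\ge 1$ let $\phi_n(u):=\mathbb{E}[e^{iuS_n}]$, $u\in\mathbb{R}$, be the characteristic function of $S_n$. Then for every $n\ge1$ and $u\in\mathbb{R}$, $$\phi_{n+1}(u)=\cos(u)\,\phi_n(u)+\frac{\alpha\sin(u)}{n}\frac{\mathrm{d}}{\mathrm{d}u}\phi_n(u),$$ with $\phi_n(0)=1$ for each $n\ge 1$. (ii) For $r\ge 1$ let $\mu_n^{(r)}:=\mathbb{E}[S_n^r]$ be the $r$th moment of $S_n$. Then for all $r\ge1$ and $n\ge1$, $$\mu_{n+1}^{(r)}=\mathbb{I}\{r\text{ is even}\}+\Big(1+\frac{\alpha}{n}r\Big)\mu_n^{(r)}+\sum_{\substack{1\le l\le r-1,\\ l\text{ even}}}\bigg[\binom{r}{l}+\frac{\alpha}{n}\binom{r}{l+1}\bigg]\mu_n^{(r-l)},$$ where $\mathbb{I}$ denotes the indicator and an empty sum is $0$.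
   Context: Elephant random walk (ERW): let $q\in(0,1]$ and $p\in(0,1)$. The first step $X_1$ satisfies $\mathbb{P}\{X_1=1\}=q$, $\mathbb{P}\{X_1=-1\}=1-q$. For $n\ge1$, let $U_n$ be uniformly distributed on $\{1,\dots,n\}$; then $X_{n+1}=X_{U_n}$ with probability $p$ and $X_{n+1}=-X_{U_n}$ with probability $1-p$, where $U_n$ and the choice of sign are independent of each other and of $(X_1,\dots,X_n)$. The walk is $S_0=0$, $S_n=X_1+\dots+X_n$ for $n\ge1$. The number $p$ is called the memory parameter. *)

theory Defs
  imports "HOL-Probability.Probability"
begin

text \<open>
  \<open>U n\<close> is the index of the step recalled at time \<open>n + 1\<close>, and \<open>B n\<close> says whether that step is
  repeated (\<open>True\<close>) or reversed (\<open>False\<close>). The random variables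
  \<open>U n\<close>, \<open>B n\<close> and \<open>(X 1, ..., X n)\<close> have different value types, so their mutual independence is
  stated as independence of the three sigma-algebras they generate. Only \<open>X n\<close>,
  \<open>U n\<close>, \<open>B n\<close> with \<open>n \<ge> 1\<close> are constrained.
\<close>

locale elephant_random_walk = prob_space M
  for M :: "'a measure" +
  fixes q p :: real
    and X :: "nat \<Rightarrow> 'a \<Rightarrow> real"
    and U :: "nat \<Rightarrow> 'a \<Rightarrow> nat"
    and B :: "nat \<Rightarrow> 'a \<Rightarrow> bool"
  assumes q_range: "q \<in> {0<..1}"
    and p_range: "p \<in> {0<..<1}"
    and X_measurable: "\<And>n. n \<ge> 1 \<Longrightarrow> random_variable borel (X n)"
    and first_step_pos: "\<P>(\<omega> in M. X 1 \<omega> = 1) = q"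
    and first_step_neg: "\<P>(\<omega> in M. X 1 \<omega> = - 1) = 1 - q"
    and U_measurable: "\<And>n. n \<ge> 1 \<Longrightarrow> random_variable (count_space UNIV) (U n)"
    and U_uniform: "\<And>n. n \<ge> 1 \<Longrightarrow>
      distr M (count_space UNIV) (U n) = measure_pmf (pmf_of_set {1..n})"
    and B_measurable: "\<And>n. n \<ge> 1 \<Longrightarrow> random_variable (count_space UNIV) (B n)"
    and B_bernoulli: "\<And>n. n \<ge> 1 \<Longrightarrow> \<P>(\<omega> in M. B n \<omega>) = p"
    and next_step: "\<And>n. n \<ge> 1 \<Longrightarrow>
      AE \<omega> in M. X (Suc n) \<omega> = (if B n \<omega> then X (U n \<omega>) \<omega> else - X (U n \<omega>) \<omega>)"
    and independence: "\<And>n. n \<ge> 1 \<Longrightarrow>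
      indep_sets ((!)
        [sets (vimage_algebra (space M) (U n) (count_space UNIV)),
         sets (vimage_algebra (space M) (B n) (count_space UNIV)),
         sets (vimage_algebra (space M) (\<lambda>\<omega>. \<lambda>k\<in>{1..n}. X k \<omega>) (Pi\<^sub>M {1..n} (\<lambda>_. borel)))])
        {..<3}"

definition walk :: "(nat \<Rightarrow> 'a \<Rightarrow> real) \<Rightarrow> nat \<Rightarrow> 'a \<Rightarrow> real"
  where "walk X n \<omega> = (\<Sum>k=1..n. X k \<omega>)"

definition walk_char :: "'a measure \<Rightarrow> (nat \<Rightarrow> 'a \<Rightarrow> real) \<Rightarrow> nat \<Rightarrow> real \<Rightarrow> complex"
  where "walk_char M X n = char (distr M borel (walk X n))"

definition walk_moment :: "'a measure \<Rightarrow> (nat \<Rightarrow> 'a \<Rightarrow> real) \<Rightarrow> nat \<Rightarrow> nat \<Rightarrow> real"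
  where "walk_moment M X r n = (\<integral>\<omega>. walk X n \<omega> ^ r \<partial>M)"

end

theory Submission
  imports Defs
begin

text \<open>
  Write \<open>\<alpha> = 2 p - 1\<close>. Conditionally on the first \<open>n\<close> steps, the next step is a uniformly chosen
  one of them multiplied by an independent sign of mean \<open>\<alpha>\<close>, so its conditional mean is
  \<open>\<alpha> S\<^sub>n / n\<close>. A step takes only the values \<open>1\<close> and \<open>-1\<close>, so this mean determines its
  conditional law, and
    \<open>E f(S\<^sub>n\<^sub>+\<^sub>1) = E [(f(S\<^sub>n + 1) + f(S\<^sub>n - 1)) / 2] + (\<alpha> / n) E [S\<^sub>n (f(S\<^sub>n + 1) - f(S\<^sub>n - 1)) / 2]\<close>
  for every Borel function \<open>f\<close> (\<open>walk_markov_recursion\<close>). Both claims are instances of this identity.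

  For \<open>f(s) = exp(i u s)\<close>, the half sum is \<open>cos u f(s)\<close> and the half difference is \<open>i sin u f(s)\<close>;
  the factor \<open>i S\<^sub>n f(S\<^sub>n)\<close> left in the second expectation is the \<open>u\<close>-derivative of \<open>f(S\<^sub>n)\<close>.
  For \<open>f(s) = s\<^sup>r\<close>, the binomial theorem turns the half sum into the terms of even index and the half
  difference into those of odd index; the factor \<open>S\<^sub>n\<close> raises the powers in the latter by one, which
  shifts the odd indices to even ones and lets the two sums be merged.

  Conditional expectations are avoided: \<open>expectation_next_step\<close> expresses the conditional mean through
  test functions \<open>g(S\<^sub>n)\<close>. Questions of integrability and of differentiating under the integral sign
  disappear because \<open>S\<^sub>n\<close> takes only finitely many values, so that every expectation of a function
  of \<open>S\<^sub>n\<close> is a finite sum (\<open>has_bochner_integral_finite_valued\<close>).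
\<close>

section \<open>Expectations of functions of a finite-valued variable\<close>

text \<open>
  The weight \<open>Z\<close> is taken to be \<open>1\<close>, a step or the walk itself. The formula is linear in the values
  of \<open>f\<close>, so that an identity between weighted expectations need only be known for indicators
  to hold for functions with values in any separable Banach space.
\<close>

lemma (in prob_space) has_bochner_integral_finite_valued:
  fixes f :: "'b::t2_space \<Rightarrow> 'c::{banach, second_countable_topology}"
  assumes Z: "integrable M Z" and Y: "random_variable borel Y"
    and f: "f \<in> borel_measurable borel"
    and K: "finite K" "AE \<omega> in M. Y \<omega> \<in> K"
  shows "has_bochner_integral M (\<lambda>\<omega>. Z \<omega> *\<^sub>R f (Y \<omega>))
           (\<Sum>k\<in>K. (\<integral>\<omega>. Z \<omega> * indicator {k} (Y \<omega>) \<partial>M) *\<^sub>R f k)"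
proof -
  have Zm: "Z \<in> borel_measurable M" using Z by simp
  have meas [measurable]: "(\<lambda>\<omega>. indicator {k} (Y \<omega>) :: real) \<in> borel_measurable M" for k
    using Y by measurable
  have int: "integrable M (\<lambda>\<omega>. Z \<omega> * indicator {k} (Y \<omega>))" for k
    using Z
  proof (rule Bochner_Integration.integrable_bound)
    show "AE \<omega> in M. norm (Z \<omega> * indicator {k} (Y \<omega>)) \<le> norm (Z \<omega>)"
      by (auto simp: indicator_def)
  qed (use Zm in measurable)
  have "has_bochner_integral M (\<lambda>\<omega>. \<Sum>k\<in>K. (Z \<omega> * indicator {k} (Y \<omega>)) *\<^sub>R f k)
           (\<Sum>k\<in>K. (\<integral>\<omega>. Z \<omega> * indicator {k} (Y \<omega>) \<partial>M) *\<^sub>R f k)"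
    using int by (intro has_bochner_integral_sum has_bochner_integral_scaleR_left
        has_bochner_integral_integrable)
  moreover have "AE \<omega> in M. (\<Sum>k\<in>K. (Z \<omega> * indicator {k} (Y \<omega>)) *\<^sub>R f k) = Z \<omega> *\<^sub>R f (Y \<omega>)"
    using K(2)
  proof eventually_elim
    case (elim \<omega>)
    have "(\<Sum>k\<in>K. (Z \<omega> * indicator {k} (Y \<omega>)) *\<^sub>R f k)
        = (\<Sum>k\<in>K. if k = Y \<omega> then Z \<omega> *\<^sub>R f k else 0)"
      by (intro sum.cong) (auto simp: indicator_def)
    with elim K(1) show ?case by simp
  qed
  moreover have "(\<lambda>\<omega>. Z \<omega> *\<^sub>R f (Y \<omega>)) \<in> borel_measurable M"
    using Zm measurable_compose[OF Y f] by measurable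
  ultimately show ?thesis
    by (subst has_bochner_integral_cong_AE[symmetric, rotated 2]) auto
qed

section \<open>The steps and the range of the walk\<close>

context elephant_random_walk
begin

lemma recalled_index_in_range:
  assumes "n \<ge> 1"
  shows "AE \<omega> in M. U n \<omega> \<in> {1..n}"
proof -
  have "AE j in distr M (count_space UNIV) (U n). j \<in> {1..n}"
    unfolding U_uniform[OF assms] using assms by (simp add: AE_measure_pmf_iff)
  then show ?thesis
    using U_measurable[OF assms] by (subst (asm) AE_distr_iff) auto
qed

lemma prob_recalled_index:
  assumes "j \<in> {1..n}"
  shows "prob {\<omega> \<in> space M. U n \<omega> = j} = 1 / real n"
proof -
  have n: "n \<ge> 1" using assms by simp
  have "prob {\<omega> \<in> space M. U n \<omega> = j} = measure (distr M (count_space UNIV) (U n)) {j}"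
    using U_measurable[OF n] by (subst measure_distr) (auto intro!: arg_cong[where f=prob])
  also have "\<dots> = 1 / real n"
    using assms n by (simp add: U_uniform measure_pmf_of_set)
  finally show ?thesis .
qed

lemma steps_pm_one: "AE \<omega> in M. \<forall>k\<in>{1..n}. X k \<omega> \<in> {-1, 1}"
proof (induction n)
  case 0
  then show ?case by simp
next
  case (Suc n)
  show ?case
  proof (cases "n = 0")
    case True
    have [measurable]: "random_variable borel (X 1)" using X_measurable by blast
    then have [measurable]: "random_variable borel (X (Suc 0))" by simp
    have "prob ({\<omega> \<in> space M. X 1 \<omega> = 1} \<union> {\<omega> \<in> space M. X 1 \<omega> = -1})
        = prob {\<omega> \<in> space M. X 1 \<omega> = 1} + prob {\<omega> \<in> space M. X 1 \<omega> = -1}"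
      by (intro finite_measure_Union) (measurable, auto)
    also have "\<dots> = 1" using first_step_pos first_step_neg by simp
    also have "{\<omega> \<in> space M. X 1 \<omega> = 1} \<union> {\<omega> \<in> space M. X 1 \<omega> = -1}
        = {\<omega> \<in> space M. X 1 \<omega> = 1 \<or> X 1 \<omega> = -1}" by auto
    finally have "AE \<omega> in M. X 1 \<omega> = 1 \<or> X 1 \<omega> = -1"
      by (subst (asm) prob_Collect_eq_1) measurable
    then show ?thesis using True by (simp add: disj_commute)
  next
    case False
    then have n: "n \<ge> 1" by simp
    from Suc recalled_index_in_range[OF n] next_step[OF n] show ?thesis
    proof eventually_elim
      case (elim \<omega>)
      then have "X (Suc n) \<omega> \<in> {-1, 1}" by (auto split: if_splits)
      with elim(1) show ?case by (auto simp: le_Suc_eq)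
    qed
  qed
qed

lemma walk_measurable [measurable]: "random_variable borel (walk X n)"
  unfolding walk_def using X_measurable by (intro borel_measurable_sum) auto

definition walk_range :: "nat \<Rightarrow> real set"
  where "walk_range n = real_of_int ` {- int n..int n}"

lemma finite_walk_range [simp]: "finite (walk_range n)"
  by (simp add: walk_range_def)

lemma walk_in_walk_range: "AE \<omega> in M. walk X n \<omega> \<in> walk_range n"
  using steps_pm_one[of n]
proof eventually_elim
  case (elim \<omega>)
  have "walk X m \<omega> \<in> walk_range m" if "m \<le> n" for m
    using that
  proof (induction m)
    case 0
    then show ?case by (simp add: walk_def walk_range_def)
  next
    case (Suc m)
    then obtain z where "walk X m \<omega> = of_int z" "\<bar>z\<bar> \<le> int m"
      by (auto simp: walk_range_def)
    moreover have "X (Suc m) \<omega> \<in> {-1, 1}" using elim Suc.prems by simp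
    ultimately have "walk X (Suc m) \<omega> = of_int (z - 1) \<and> \<bar>z - 1\<bar> \<le> int (Suc m)
        \<or> walk X (Suc m) \<omega> = of_int (z + 1) \<and> \<bar>z + 1\<bar> \<le> int (Suc m)"
      by (auto simp: walk_def)
    then show ?case unfolding walk_range_def by fastforce
  qed
  then show ?case by simp
qed

lemma has_bochner_integral_weighted_walk:
  fixes f :: "real \<Rightarrow> 'c::{banach, second_countable_topology}"
  assumes "integrable M Z" "f \<in> borel_measurable borel"
  shows "has_bochner_integral M (\<lambda>\<omega>. Z \<omega> *\<^sub>R f (walk X n \<omega>))
     (\<Sum>k\<in>walk_range n. (\<integral>\<omega>. Z \<omega> * indicator {k} (walk X n \<omega>) \<partial>M) *\<^sub>R f k)"
  using assms walk_in_walk_range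
  by (intro has_bochner_integral_finite_valued) auto

lemma has_bochner_integral_walk:
  fixes f :: "real \<Rightarrow> 'c::{banach, second_countable_topology}"
  assumes "f \<in> borel_measurable borel"
  shows "has_bochner_integral M (\<lambda>\<omega>. f (walk X n \<omega>))
     (\<Sum>k\<in>walk_range n. (\<integral>\<omega>. indicator {k} (walk X n \<omega>) \<partial>M) *\<^sub>R f k)"
  using has_bochner_integral_weighted_walk[of "\<lambda>_. 1" f n] assms by simp


section \<open>The conditional mean of the next step\<close>

definition sign_factor :: "nat \<Rightarrow> 'a \<Rightarrow> real"
  where "sign_factor n \<omega> = (if B n \<omega> then 1 else - 1)"

lemma sign_factor_measurable [measurable]:
  assumes "n \<ge> 1" shows "random_variable borel (sign_factor n)"
  using B_measurable[OF assms] unfolding sign_factor_def by measurable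

lemma expectation_sign_factor:
  assumes "n \<ge> 1"
  shows "expectation (sign_factor n) = 2 * p - 1"
proof -
  note [measurable] = B_measurable[OF assms]
  have ev: "{\<omega> \<in> space M. B n \<omega>} \<in> events" by measurable
  have "sign_factor n \<omega> = 2 * indicator {\<omega> \<in> space M. B n \<omega>} \<omega> - 1" if "\<omega> \<in> space M" for \<omega>
    using that by (simp add: sign_factor_def)
  then have "expectation (sign_factor n)
      = (\<integral>\<omega>. 2 * indicator {\<omega> \<in> space M. B n \<omega>} \<omega> - 1 \<partial>M)"
    by (intro Bochner_Integration.integral_cong) auto
  also have "\<dots> = 2 * p - 1"
    using B_bernoulli[OF assms] ev
    by (subst Bochner_Integration.integral_diff) (auto simp: prob_space less_top[symmetric])
  finally show ?thesis .
qed

lemma integrable_step: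
  assumes "k \<ge> 1"
  shows "integrable M (X k)"
proof (rule integrable_const_bound[where B = 1])
  show "AE \<omega> in M. norm (X k \<omega>) \<le> 1"
    using steps_pm_one[of k] by eventually_elim (use assms in force)
qed (use X_measurable assms in auto)

lemma integrable_step_times_walk:
  fixes g :: "real \<Rightarrow> 'c::{banach, second_countable_topology}"
  assumes "k \<ge> 1" "g \<in> borel_measurable borel"
  shows "integrable M (\<lambda>\<omega>. X k \<omega> *\<^sub>R g (walk X n \<omega>))"
  using has_bochner_integral_weighted_walk[OF integrable_step[OF assms(1)] assms(2)]
  by (simp add: has_bochner_integral_iff)

text \<open>
  The three factors depend on \<open>U n\<close>, on \<open>B n\<close> and on the past respectively, so the
  expectation of their product factorises into \<open>1 / n\<close>, \<open>2 p - 1\<close> and the last expectation.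
\<close>

lemma expectation_recalled_step:
  fixes g :: "real \<Rightarrow> real"
  assumes n: "n \<ge> 1" and j: "j \<in> {1..n}" and g: "g \<in> borel_measurable borel"
  defines "V \<equiv> (!) [\<lambda>\<omega>. indicator {j} (U n \<omega>), sign_factor n, \<lambda>\<omega>. X j \<omega> * g (walk X n \<omega>)]"
  shows "has_bochner_integral M
     (\<lambda>\<omega>. indicator {j} (U n \<omega>) * sign_factor n \<omega> * (X j \<omega> * g (walk X n \<omega>)))
     ((2 * p - 1) / real n * (\<integral>\<omega>. X j \<omega> * g (walk X n \<omega>) \<partial>M))"
proof -
  note [measurable] = g U_measurable[OF n] B_measurable[OF n] sign_factor_measurable[OF n]
  let ?A = "(!) [vimage_algebra (space M) (U n) (count_space UNIV),
       vimage_algebra (space M) (B n) (count_space UNIV),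
       vimage_algebra (space M) (\<lambda>\<omega>. \<lambda>k\<in>{1..n}. X k \<omega>) (Pi\<^sub>M {1..n} (\<lambda>_. borel))]"
  have three: "{..<3} = {0, 1, 2::nat}" by auto
  \<comment> \<open>The walk at time \<open>n\<close> is a function of the first \<open>n\<close> steps alone, hence measurable
     with respect to the sigma-algebra that they generate.\<close>
  have past: "(\<lambda>\<omega>. X j \<omega> * g (walk X n \<omega>))
       \<in> borel_measurable (vimage_algebra (space M) (\<lambda>\<omega>. \<lambda>k\<in>{1..n}. X k \<omega>) (Pi\<^sub>M {1..n} (\<lambda>_. borel)))"
  proof -
    have "(\<lambda>\<omega>. \<lambda>k\<in>{1..n}. X k \<omega>) \<in> vimage_algebra (space M) (\<lambda>\<omega>. \<lambda>k\<in>{1..n}. X k \<omega>) (Pi\<^sub>M {1..n} (\<lambda>_. borel))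
        \<rightarrow>\<^sub>M Pi\<^sub>M {1..n} (\<lambda>_. borel)"
      by (rule measurable_vimage_algebra1) (auto simp: space_PiM)
    moreover have "(\<lambda>x. x j * g (\<Sum>k=1..n. x k)) \<in> borel_measurable (Pi\<^sub>M {1..n} (\<lambda>_. borel))"
      using j by measurable
    ultimately have "(\<lambda>\<omega>. (\<lambda>x. x j * g (\<Sum>k=1..n. x k)) (\<lambda>k\<in>{1..n}. X k \<omega>))
       \<in> borel_measurable (vimage_algebra (space M) (\<lambda>\<omega>. \<lambda>k\<in>{1..n}. X k \<omega>) (Pi\<^sub>M {1..n} (\<lambda>_. borel)))"
      by (rule measurable_compose)
    then show ?thesis using j by (simp add: walk_def)
  qed
  have V_meas: "V i \<in> borel_measurable (?A i)" if "i \<in> {..<3}" for i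
  proof -
    have "sign_factor n \<in> borel_measurable (vimage_algebra (space M) (B n) (count_space UNIV))"
      unfolding sign_factor_def
      by (rule measurable_compose[OF measurable_vimage_algebra1]) auto
    moreover have "(\<lambda>\<omega>. indicator {j} (U n \<omega>) :: real)
        \<in> borel_measurable (vimage_algebra (space M) (U n) (count_space UNIV))"
      by (rule measurable_compose[OF measurable_vimage_algebra1]) auto
    ultimately show ?thesis
      using that past unfolding three V_def by auto
  qed
  have int_past: "integrable M (\<lambda>\<omega>. X j \<omega> * g (walk X n \<omega>))"
    using integrable_step_times_walk[of j g n] j g by simp
  have V_int: "integrable M (V i)" if "i \<in> {..<3}" for i
  proof -
    have "integrable M (sign_factor n)"
      by (rule integrable_const_bound[where B = 1]) (auto simp: sign_factor_def)
    moreover have "integrable M (\<lambda>\<omega>. indicator {j} (U n \<omega>) :: real)"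
      by (rule integrable_const_bound[where B = 1]) (auto simp: indicator_def)
    ultimately show ?thesis
      using that int_past unfolding three V_def by auto
  qed
  have "indep_sets (\<lambda>i. {V i -` C \<inter> space M | C. C \<in> sets borel}) {..<3}"
    using independence[OF n]
  proof (rule indep_sets_mono_sets)
    fix i :: nat assume i: "i \<in> {..<3}"
    have "space (?A i) = space M" using i unfolding three by auto
    then have "{V i -` C \<inter> space M | C. C \<in> sets borel} \<subseteq> sets (?A i)"
      using measurable_sets[OF V_meas[OF i]] by auto
    also have "sets (?A i) = [sets (vimage_algebra (space M) (U n) (count_space UNIV)),
         sets (vimage_algebra (space M) (B n) (count_space UNIV)),
         sets (vimage_algebra (space M) (\<lambda>\<omega>. \<lambda>k\<in>{1..n}. X k \<omega>) (Pi\<^sub>M {1..n} (\<lambda>_. borel)))] ! i"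
      using i unfolding three by auto
    finally show "{V i -` C \<inter> space M | C. C \<in> sets borel} \<subseteq> \<dots>" .
  qed
  then have indep: "indep_vars (\<lambda>_. borel) V {..<3}"
    unfolding indep_vars_def2 using V_int by auto
  have "integrable M (\<lambda>\<omega>. \<Prod>i<3. V i \<omega>)"
    using indep V_int by (intro indep_vars_integrable) auto
  moreover have "(\<integral>\<omega>. (\<Prod>i<3. V i \<omega>) \<partial>M) = (\<Prod>i<3. \<integral>\<omega>. V i \<omega> \<partial>M)"
    using indep V_int by (intro indep_vars_lebesgue_integral) auto
  moreover have "(\<integral>\<omega>. indicator {j} (U n \<omega>) \<partial>M) = 1 / real n"
  proof -
    have "(\<integral>\<omega>. (indicator {j} (U n \<omega>) :: real) \<partial>M)
        = (\<integral>\<omega>. indicator {\<omega> \<in> space M. U n \<omega> = j} \<omega> \<partial>M)"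
      by (intro Bochner_Integration.integral_cong) (auto simp: indicator_def)
    then show ?thesis using prob_recalled_index[OF j] by simp
  qed
  ultimately show ?thesis
    using expectation_sign_factor[OF n]
    by (simp add: has_bochner_integral_iff three V_def mult.assoc)
qed

text \<open>
  Splitting according to which step is recalled gives \<open>n\<close> terms in which \<open>X j\<close> replaces the next
  step at the cost of the same factor \<open>(2 p - 1) / n\<close>; the \<open>X j\<close> then add up to the walk.
\<close>

lemma expectation_next_step_real:
  fixes g :: "real \<Rightarrow> real"
  assumes n: "n \<ge> 1" and g: "g \<in> borel_measurable borel"
  shows "(\<integral>\<omega>. X (Suc n) \<omega> * g (walk X n \<omega>) \<partial>M)
       = (2 * p - 1) / real n * (\<integral>\<omega>. walk X n \<omega> * g (walk X n \<omega>) \<partial>M)"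
proof -
  note [measurable] = g U_measurable[OF n] sign_factor_measurable[OF n]
  have X_meas [measurable]: "random_variable borel (X (Suc n))"
    using X_measurable by simp
  have Xj: "random_variable borel (X j)" if "j \<in> {1..n}" for j
    using X_measurable that by simp
  have "AE \<omega> in M. X (Suc n) \<omega> * g (walk X n \<omega>)
     = (\<Sum>j\<in>{1..n}. indicator {j} (U n \<omega>) * sign_factor n \<omega> * (X j \<omega> * g (walk X n \<omega>)))"
    using next_step[OF n] recalled_index_in_range[OF n]
  proof eventually_elim
    case (elim \<omega>)
    have "(\<Sum>j\<in>{1..n}. indicator {j} (U n \<omega>) * sign_factor n \<omega> * (X j \<omega> * g (walk X n \<omega>)))
       = (\<Sum>j\<in>{1..n}. if j = U n \<omega> then sign_factor n \<omega> * (X j \<omega> * g (walk X n \<omega>)) else 0)"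
      by (intro sum.cong) auto
    with elim show ?case by (auto simp: sign_factor_def)
  qed
  then have "(\<integral>\<omega>. X (Suc n) \<omega> * g (walk X n \<omega>) \<partial>M)
     = (\<integral>\<omega>. (\<Sum>j\<in>{1..n}. indicator {j} (U n \<omega>) * sign_factor n \<omega> * (X j \<omega> * g (walk X n \<omega>))) \<partial>M)"
    using Xj by (intro integral_cong_AE borel_measurable_sum borel_measurable_times
        measurable_compose[OF U_measurable[OF n]] measurable_compose[OF walk_measurable g]) auto
  also have "\<dots> = (\<Sum>j\<in>{1..n}. (2 * p - 1) / real n * (\<integral>\<omega>. X j \<omega> * g (walk X n \<omega>) \<partial>M))"
    using expectation_recalled_step[OF n _ g]
    by (intro has_bochner_integral_integral_eq has_bochner_integral_sum) auto
  also have "\<dots> = (2 * p - 1) / real n * (\<integral>\<omega>. (\<Sum>j\<in>{1..n}. X j \<omega> * g (walk X n \<omega>)) \<partial>M)"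
    using integrable_step_times_walk[OF _ g]
    by (subst Bochner_Integration.integral_sum) (auto simp: sum_distrib_left)
  finally show ?thesis by (simp add: walk_def sum_distrib_right)
qed

text \<open>
  Independence factorises expectations of products of real variables; vector-valued test functions,
  such as the complex exponential, are reached by expanding over the finite range of the walk.
\<close>

lemma expectation_next_step:
  fixes g :: "real \<Rightarrow> 'c::{banach, second_countable_topology}"
  assumes n: "n \<ge> 1" and g: "g \<in> borel_measurable borel"
  shows "(\<integral>\<omega>. X (Suc n) \<omega> *\<^sub>R g (walk X n \<omega>) \<partial>M)
       = ((2 * p - 1) / real n) *\<^sub>R (\<integral>\<omega>. walk X n \<omega> *\<^sub>R g (walk X n \<omega>) \<partial>M)"
proof -
  have "integrable M (walk X n)"
    using integrable_step unfolding walk_def by (intro Bochner_Integration.integrable_sum) auto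
  note walk = has_bochner_integral_weighted_walk[OF this g, of n]
  note step = has_bochner_integral_weighted_walk[OF integrable_step g, of "Suc n" n]
  have "(\<integral>\<omega>. X (Suc n) \<omega> * indicator {k} (walk X n \<omega>) \<partial>M)
      = (2 * p - 1) / real n * (\<integral>\<omega>. walk X n \<omega> * indicator {k} (walk X n \<omega>) \<partial>M)" for k
    by (rule expectation_next_step_real[OF n]) simp
  then show ?thesis
    using walk step by (simp add: has_bochner_integral_iff scaleR_right.sum)
qed

text \<open>
  Every function of \<open>x \<in> {-1, 1}\<close> is affine in \<open>x\<close>, so that \<open>f(s + x)\<close> is the half sum of
  \<open>f(s + 1)\<close> and \<open>f(s - 1)\<close> plus \<open>x\<close> times their half difference. The next step thus enters
  linearly, and \<open>expectation_next_step\<close> applies.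
\<close>

lemma walk_markov_recursion:
  fixes f :: "real \<Rightarrow> 'c::{banach, second_countable_topology}"
  assumes n: "n \<ge> 1" and f: "f \<in> borel_measurable borel"
  shows "(\<integral>\<omega>. f (walk X (Suc n) \<omega>) \<partial>M)
     = (\<integral>\<omega>. (1/2) *\<^sub>R (f (walk X n \<omega> + 1) + f (walk X n \<omega> - 1)) \<partial>M)
     + ((2 * p - 1) / real n) *\<^sub>R
         (\<integral>\<omega>. walk X n \<omega> *\<^sub>R ((1/2) *\<^sub>R (f (walk X n \<omega> + 1) - f (walk X n \<omega> - 1))) \<partial>M)"
proof -
  note [measurable] = f
  have X_meas [measurable]: "random_variable borel (X (Suc n))"
    using X_measurable by simp
  define e where "e s = (1/2) *\<^sub>R (f (s + 1) + f (s - 1))" for s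
  define d where "d s = (1/2) *\<^sub>R (f (s + 1) - f (s - 1))" for s
  have [measurable]: "e \<in> borel_measurable borel" "d \<in> borel_measurable borel"
    unfolding e_def d_def by measurable
  have split: "e s + d s = f (s + 1)" "e s - d s = f (s - 1)" for s
    by (simp_all add: e_def d_def algebra_simps flip: scaleR_add_left)
  have "AE \<omega> in M. f (walk X (Suc n) \<omega>) = e (walk X n \<omega>) + X (Suc n) \<omega> *\<^sub>R d (walk X n \<omega>)"
    using steps_pm_one[of "Suc n"]
  proof eventually_elim
    case (elim \<omega>)
    then have "X (Suc n) \<omega> \<in> {-1, 1}" by simp
    then show ?case
      by (auto simp: walk_def split)
  qed
  then have "(\<integral>\<omega>. f (walk X (Suc n) \<omega>) \<partial>M)
      = (\<integral>\<omega>. e (walk X n \<omega>) + X (Suc n) \<omega> *\<^sub>R d (walk X n \<omega>) \<partial>M)"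
    by (intro integral_cong_AE) auto
  also have "\<dots> = (\<integral>\<omega>. e (walk X n \<omega>) \<partial>M) + (\<integral>\<omega>. X (Suc n) \<omega> *\<^sub>R d (walk X n \<omega>) \<partial>M)"
    using has_bochner_integral_walk[of e n] integrable_step_times_walk[of "Suc n" d n]
    by (intro Bochner_Integration.integral_add) (auto simp: has_bochner_integral_iff)
  finally show ?thesis
    using expectation_next_step[OF n, of d] by (simp add: e_def d_def)
qed

section \<open>The characteristic function\<close>

lemma walk_char_eq: "walk_char M X n u = (\<integral>\<omega>. cis (u * walk X n \<omega>) \<partial>M)"
  unfolding walk_char_def char_def by (subst integral_distr) (auto simp: cis_conv_exp)

text \<open>
  The characteristic function is a finite sum of terms \<open>P(S\<^sub>n = k) exp(i u k)\<close>, and can be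
  differentiated term by term.
\<close>

lemma walk_char_has_vector_derivative:
  "(walk_char M X n has_vector_derivative
      (\<integral>\<omega>. walk X n \<omega> *\<^sub>R (\<i> * cis (u * walk X n \<omega>)) \<partial>M)) (at u)"
proof -
  let ?P = "\<lambda>k. \<integral>\<omega>. indicator {k} (walk X n \<omega>) \<partial>M"
  have [measurable]: "(\<lambda>s. cis (v * s)) \<in> borel_measurable borel" for v
    by (intro borel_measurable_continuous_onI continuous_intros)
  have "walk_char M X n = (\<lambda>v. \<Sum>k\<in>walk_range n. ?P k *\<^sub>R cis (v * k))"
    using has_bochner_integral_walk[of "\<lambda>s. cis (_ * s)" n]
    by (auto simp: walk_char_eq has_bochner_integral_iff fun_eq_iff)
  moreover have "(\<integral>\<omega>. walk X n \<omega> *\<^sub>R (\<i> * cis (u * walk X n \<omega>)) \<partial>M)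
      = (\<Sum>k\<in>walk_range n. ?P k *\<^sub>R (k *\<^sub>R (\<i> * cis (u * k))))"
    using has_bochner_integral_walk[of "\<lambda>s. s *\<^sub>R (\<i> * cis (u * s))" n]
    by (auto simp: has_bochner_integral_iff)
  moreover have "((\<lambda>v. cis (v * k)) has_vector_derivative k *\<^sub>R (\<i> * cis (u * k))) (at u)" for k
  proof -
    have "((\<lambda>v. Complex (cos (v * k)) (sin (v * k))) has_vector_derivative
        Complex (- (k * sin (u * k))) (k * cos (u * k))) (at u)"
      unfolding has_vector_derivative_complex_iff
      by (auto intro!: derivative_eq_intros simp: has_real_derivative_iff_has_vector_derivative[symmetric])
    moreover have "(\<lambda>v. Complex (cos (v * k)) (sin (v * k))) = (\<lambda>v. cis (v * k))"
      by (auto simp: complex_eq_iff)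
    moreover have "Complex (- (k * sin (u * k))) (k * cos (u * k)) = k *\<^sub>R (\<i> * cis (u * k))"
      by (simp add: complex_eq_iff)
    ultimately show ?thesis by simp
  qed
  ultimately show ?thesis
    by (auto intro!: has_vector_derivative_sum has_vector_derivative_scaleR derivative_eq_intros)
qed

lemma walk_char_recursion:
  assumes n: "n \<ge> 1"
  shows "walk_char M X (Suc n) u = of_real (cos u) * walk_char M X n u
    + complex_of_real ((2 * p - 1) * sin u / real n) * vector_derivative (walk_char M X n) (at u)"
proof -
  have [measurable]: "(\<lambda>s. cis (v * s)) \<in> borel_measurable borel" for v
    by (intro borel_measurable_continuous_onI continuous_intros)
  have avg: "(1/2) *\<^sub>R (cis (u * (s + 1)) + cis (u * (s - 1))) = of_real (cos u) * cis (u * s)" for s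
    by (simp add: complex_eq_iff cos_add sin_add cos_diff sin_diff algebra_simps)
  have diff: "s *\<^sub>R ((1/2) *\<^sub>R (cis (u * (s + 1)) - cis (u * (s - 1))))
      = of_real (sin u) * (s *\<^sub>R (\<i> * cis (u * s)))" for s
    by (simp add: complex_eq_iff cos_add sin_add cos_diff sin_diff algebra_simps)
  have "walk_char M X (Suc n) u = of_real (cos u) * walk_char M X n u
    + ((2 * p - 1) / real n) *\<^sub>R (of_real (sin u) * (\<integral>\<omega>. walk X n \<omega> *\<^sub>R (\<i> * cis (u * walk X n \<omega>)) \<partial>M))"
    unfolding walk_char_eq
    by (subst walk_markov_recursion[OF n]) (simp_all only: avg diff integral_mult_right_zero, simp)
  then show ?thesis
    using vector_derivative_at[OF walk_char_has_vector_derivative, of n u]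
    by (simp add: scaleR_conv_of_real algebra_simps)
qed

section \<open>The moments\<close>

lemma integrable_walk_power: "integrable M (\<lambda>\<omega>. walk X n \<omega> ^ r)"
  using has_bochner_integral_walk[of "\<lambda>s. s ^ r" n] by (simp add: has_bochner_integral_iff)

end

lemma binomial_even_part:
  fixes s :: "'a::field_char_0"
  shows "((s + 1) ^ r + (s - 1) ^ r) / 2 = (\<Sum>l | l \<le> r \<and> even l. of_nat (r choose l) * s ^ (r - l))"
proof -
  have "(s + 1) ^ r = (\<Sum>l\<le>r. of_nat (r choose l) * s ^ (r - l))"
    using binomial_ring[of 1 s r] by (simp add: add.commute)
  moreover have "(s - 1) ^ r = (\<Sum>l\<le>r. (-1) ^ l * (of_nat (r choose l) * s ^ (r - l)))"
    using binomial_ring[of "-1" s r] by (simp add: algebra_simps)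
  ultimately have "((s + 1) ^ r + (s - 1) ^ r) / 2
     = (\<Sum>l\<le>r. (1 + (-1) ^ l) / 2 * (of_nat (r choose l) * s ^ (r - l)))"
    by (simp add: sum_divide_distrib add_divide_distrib distrib_right sum.distrib)
  also have "\<dots> = (\<Sum>l\<le>r. if even l then of_nat (r choose l) * s ^ (r - l) else 0)"
    by (intro sum.cong) auto
  also have "\<dots> = (\<Sum>l | l \<le> r \<and> even l. of_nat (r choose l) * s ^ (r - l))"
    by (simp add: sum.If_cases Int_def)
  finally show ?thesis .
qed

text \<open>
  The summation index is one less than the index in the binomial expansion; the factor \<open>s\<close> compensates
  for this in the exponent, so that the same powers occur as in \<open>binomial_even_part\<close>.
\<close>

lemma binomial_odd_part:
  fixes s :: "'a::field_char_0"
  assumes "r \<ge> 1"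
  shows "s * (((s + 1) ^ r - (s - 1) ^ r) / 2)
       = (\<Sum>l | l \<le> r - 1 \<and> even l. of_nat (r choose (l + 1)) * s ^ (r - l))"
proof -
  have "(s + 1) ^ r = (\<Sum>l\<le>r. of_nat (r choose l) * s ^ (r - l))"
    using binomial_ring[of 1 s r] by (simp add: add.commute)
  moreover have "(s - 1) ^ r = (\<Sum>l\<le>r. (-1) ^ l * (of_nat (r choose l) * s ^ (r - l)))"
    using binomial_ring[of "-1" s r] by (simp add: algebra_simps)
  ultimately have "((s + 1) ^ r - (s - 1) ^ r) / 2
     = (\<Sum>l\<le>r. (1 - (-1) ^ l) / 2 * (of_nat (r choose l) * s ^ (r - l)))"
    by (simp add: sum_divide_distrib diff_divide_distrib left_diff_distrib sum_subtractf)
  also have "\<dots> = (\<Sum>l\<le>r. if odd l then of_nat (r choose l) * s ^ (r - l) else 0)"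
    by (intro sum.cong) auto
  also have "\<dots> = (\<Sum>l | l \<le> r \<and> odd l. of_nat (r choose l) * s ^ (r - l))"
    by (simp add: sum.If_cases Int_def)
  also have "\<dots> = (\<Sum>l | l \<le> r - 1 \<and> even l. of_nat (r choose (l + 1)) * s ^ (r - (l + 1)))"
    using assms by (intro sum.reindex_bij_witness[of _ Suc "\<lambda>l. l - 1"]) (auto elim: oddE)
  finally have "s * (((s + 1) ^ r - (s - 1) ^ r) / 2)
     = (\<Sum>l | l \<le> r - 1 \<and> even l. of_nat (r choose (l + 1)) * (s * s ^ (r - (l + 1))))"
    by (simp add: sum_distrib_left mult_ac)
  also have "\<dots> = (\<Sum>l | l \<le> r - 1 \<and> even l. of_nat (r choose (l + 1)) * s ^ (r - l))"
    using assms by (intro sum.cong) (auto simp flip: power_Suc simp: Suc_diff_Suc)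
  finally show ?thesis .
qed

text \<open>
  After merging the sums over even indices, the summand of index \<open>0\<close> is the term in the \<open>r\<close>-th moment. When
  \<open>r\<close> is even, the summand of index \<open>r\<close> occurs only in the even part of the
  binomial expansion and is the zeroth moment, \<open>1\<close>.
\<close>

lemma (in elephant_random_walk) walk_moment_recursion:
  assumes n: "n \<ge> 1" and r: "r \<ge> 1"
  shows "walk_moment M X r (Suc n) = (if even r then 1 else 0)
    + (1 + (2 * p - 1) / real n * real r) * walk_moment M X r n
    + (\<Sum>l | 1 \<le> l \<and> l \<le> r - 1 \<and> even l.
        (real (r choose l) + (2 * p - 1) / real n * real (r choose (l + 1))) * walk_moment M X (r - l) n)"
    (is "_ = _ + _ + ?rest")
proof -
  let ?m = "\<lambda>l. walk_moment M X (r - l) n" and ?a = "(2 * p - 1) / real n"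
  let ?E = "{l. 1 \<le> l \<and> l \<le> r - 1 \<and> even l}"
  have fin: "finite ?E" "finite {l. l \<le> r - 1 \<and> even l}" "finite {l. l \<le> r \<and> even l}"
    by (auto intro: finite_subset[of _ "{..r}"])
  have m0: "walk_moment M X 0 n = 1" by (simp add: walk_moment_def prob_space)
  have "walk_moment M X r (Suc n)
    = (\<integral>\<omega>. ((walk X n \<omega> + 1) ^ r + (walk X n \<omega> - 1) ^ r) / 2 \<partial>M)
      + ?a * (\<integral>\<omega>. walk X n \<omega> * (((walk X n \<omega> + 1) ^ r - (walk X n \<omega> - 1) ^ r) / 2) \<partial>M)"
    unfolding walk_moment_def by (subst walk_markov_recursion[OF n]) simp_all
  also have "\<dots> = (\<Sum>l | l \<le> r \<and> even l. real (r choose l) * ?m l)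
      + ?a * (\<Sum>l | l \<le> r - 1 \<and> even l. real (r choose (l + 1)) * ?m l)"
    unfolding binomial_even_part binomial_odd_part[OF r] walk_moment_def
    using integrable_walk_power by (simp add: Bochner_Integration.integral_sum)
  also have "(\<Sum>l | l \<le> r \<and> even l. real (r choose l) * ?m l)
      = (if even r then 1 else 0) + (\<Sum>l | l \<le> r - 1 \<and> even l. real (r choose l) * ?m l)"
  proof (cases "even r")
    case True
    then have "{l. l \<le> r \<and> even l} = insert r {l. l \<le> r - 1 \<and> even l}" using r by auto
    then show ?thesis using True r fin by (simp add: m0)
  next
    case False
    then have "l \<le> r \<and> even l \<longleftrightarrow> l \<le> r - 1 \<and> even l" for l
      by (cases "l = r") auto
    then show ?thesis using False by simp
  qed
  also have "{l. l \<le> r - 1 \<and> even l} = insert 0 ?E" by (auto simp: Suc_le_eq)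
  finally show ?thesis
    using fin(1) by (simp add: algebra_simps sum.distrib sum_distrib_left)
qed

theorem proposition2p1:
  fixes M :: "'a measure" and q p \<alpha> :: real
    and X :: "nat \<Rightarrow> 'a \<Rightarrow> real" and U :: "nat \<Rightarrow> 'a \<Rightarrow> nat" and B :: "nat \<Rightarrow> 'a \<Rightarrow> bool"
  assumes erw: "elephant_random_walk M q p X U B"
    and alpha: "\<alpha> = 2 * p - 1"
  shows
    "(\<forall>n\<ge>1. \<forall>u. walk_char M X n differentiable (at u) \<and>
        walk_char M X (n + 1) u =
          of_real (cos u) * walk_char M X n u
          + of_real (\<alpha> * sin u / real n) * vector_derivative (walk_char M X n) (at u))
     \<and> (\<forall>n\<ge>1. walk_char M X n 0 = 1)
     \<and> (\<forall>r\<ge>1. \<forall>n\<ge>1. integrable M (\<lambda>\<omega>. walk X n \<omega> ^ r))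
     \<and> (\<forall>r\<ge>1. \<forall>n\<ge>1.
        walk_moment M X r (n + 1) =
          (if even r then 1 else 0)
          + (1 + \<alpha> / real n * real r) * walk_moment M X r n
          + (\<Sum>l | 1 \<le> l \<and> l \<le> r - 1 \<and> even l.
              (real (r choose l) + \<alpha> / real n * real (r choose (l + 1)))
                * walk_moment M X (r - l) n))"
proof -
  interpret elephant_random_walk M q p X U B by (fact erw)
  have "walk_char M X n differentiable (at u)" for n u
    using walk_char_has_vector_derivative by (rule differentiableI_vector)
  moreover have "walk_char M X n 0 = 1" for n
    by (simp add: walk_char_eq prob_space)
  ultimately show ?thesis
    unfolding alpha
    using walk_char_recursion walk_moment_recursion integrable_walk_power
    by (simp add: cos_of_real sin_of_real del: of_real_mult of_real_divide)
qed

end
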